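(* Let $N\ge2$ and let $p,q$ be strictly positive probability mass vectors of size $N$. With the generalised definition of symmetric divergence $$\mathscr{D}(p,q):=D(p\|q)+D(q\|p)-D(p\|p)-D(q\|q),$$ one has $$\mathscr{D}(p,q)=\Delta(p\|q)+\Delta(q\|p)-\Delta(p\|p)-\Delta(q\|q)=CH(p\|q)+CH(q\|p)-CH(p\|p)-CH(q\|q)\ge0.$$
   Context: For strictly positive probability mass vectors $p=(p_1,\dots,p_N)$ and $q=(q_1,\dots,q_N)$: $D(p\|q)=\sum_i p_i\log(p_i/q_i)$; $\Delta(p\|q)=\sum_i(p_i-q_i)\log p_i$; the cross entropy is $CH(p\|q)=-\sum_i p_i\log q_i$. $\log$ is the natural logarithm. *)

theory Defs
  imports "HOL-Analysis.Analysis"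
begin

definition pos_prob_vec :: "real ^ 'n \<Rightarrow> bool" where
  "pos_prob_vec p \<longleftrightarrow> (\<forall>i. p $ i > 0) \<and> (\<Sum>i\<in>UNIV. p $ i) = 1"

definition divergence :: "real ^ 'n \<Rightarrow> real ^ 'n \<Rightarrow> real" where
  "divergence p q = (\<Sum>i\<in>UNIV. p $ i * ln (p $ i / q $ i))"

definition Delta :: "real ^ 'n \<Rightarrow> real ^ 'n \<Rightarrow> real" where
  "Delta p q = (\<Sum>i\<in>UNIV. (p $ i - q $ i) * ln (p $ i))"

definition cross_entropy :: "real ^ 'n \<Rightarrow> real ^ 'n \<Rightarrow> real" where
  "cross_entropy p q = - (\<Sum>i\<in>UNIV. p $ i * ln (q $ i))"

definition symmetric_divergence :: "real ^ 'n \<Rightarrow> real ^ 'n \<Rightarrow> real" where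
  "symmetric_divergence p q =
     divergence p q + divergence q p - divergence p p - divergence q q"

end

theory Submission
  imports Defs
begin

text \<open>
  A function f of two vectors contributes to the combination
  f p q + f q p - f p p - f q q only through its mixed part: any summand depending on one
  argument alone cancels. Up to such summands, the divergence, Delta and the cross entropy all
  have the same mixed part, the bilinear pairing - (\<Sum>i. p i * ln (q i)) (with the roles
  of p and q exchanged for Delta), so the three combinations coincide. Their common value is
  \<Sum>i. (p i - q i) * (ln (p i) - ln (q i)), and every term of this sum is nonnegative
  because the logarithm is increasing.
\<close>

lemma Delta_symmetrised:
  "Delta p q + Delta q p - Delta p p - Delta q q =
     (\<Sum>i\<in>UNIV. (p $ i - q $ i) * (ln (p $ i) - ln (q $ i)))"
  by (simp add: Delta_def flip: sum.distrib) (simp add: algebra_simps)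

lemma cross_entropy_symmetrised:
  "cross_entropy p q + cross_entropy q p - cross_entropy p p - cross_entropy q q =
     (\<Sum>i\<in>UNIV. (p $ i - q $ i) * (ln (p $ i) - ln (q $ i)))"
  by (simp add: cross_entropy_def algebra_simps sum.distrib sum_subtractf)

text \<open>
  The self-divergences vanish, and positivity of the entries splits the logarithm of the quotient.
\<close>

lemma symmetric_divergence_eq_sum:
  assumes "\<And>i. p $ i > 0" and "\<And>i. q $ i > 0"
  shows "symmetric_divergence p q =
     (\<Sum>i\<in>UNIV. (p $ i - q $ i) * (ln (p $ i) - ln (q $ i)))"
proof -
  have split: "divergence a b = (\<Sum>i\<in>UNIV. a $ i * (ln (a $ i) - ln (b $ i)))"
    if "\<And>i. a $ i > 0" "\<And>i. b $ i > 0" for a b :: "real ^ 'a"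
    unfolding divergence_def using that by (simp add: ln_div less_imp_neq[THEN not_sym])
  show ?thesis
    unfolding symmetric_divergence_def
    using assms by (simp add: split algebra_simps sum.distrib sum_subtractf)
qed

lemma diff_mult_ln_diff_nonneg:
  fixes x y :: real
  assumes "x > 0" and "y > 0"
  shows "(x - y) * (ln x - ln y) \<ge> 0"
  using assms by (cases "x \<le> y") (simp_all add: mult_nonpos_nonpos)

theorem theorem5:
  fixes p q :: "real ^ 'n"
  assumes "CARD('n) \<ge> 2"
    and "pos_prob_vec p" and "pos_prob_vec q"
  shows "symmetric_divergence p q = Delta p q + Delta q p - Delta p p - Delta q q
    \<and> Delta p q + Delta q p - Delta p p - Delta q q
        = cross_entropy p q + cross_entropy q p - cross_entropy p p - cross_entropy q q
    \<and> cross_entropy p q + cross_entropy q p - cross_entropy p p - cross_entropy q q \<ge> 0"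
proof -
  have "\<And>i. p $ i > 0" and "\<And>i. q $ i > 0"
    using assms by (auto simp: pos_prob_vec_def)
  then show ?thesis
    by (simp add: symmetric_divergence_eq_sum Delta_symmetrised cross_entropy_symmetrised
        sum_nonneg diff_mult_ln_diff_nonneg)
qed

end
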